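(* Let $N\ge3$, let $x_1<\cdots<x_{N+1}$ be breakpoints, and let $\mathcal H=\{\mathbf v\in\mathbb R^{N-1}:\boldsymbol\alpha^\top(\mathbf v-\mathbf c)=0\}$ be a given hyperplane, $\boldsymbol\alpha\in\mathbb R^{N-1}\setminus\{0\}$, $\mathbf c\in\mathbb R^{N-1}$. Given an outcome vector $\mathbf r=(r_0,\dots,r_N)^\top\in\mathbb R^{N+1}$ such that $$r_0=x_1\quad\text{and}\quad r_i\in(x_i,x_{i+1}],\quad i=1,\dots,N,$$ there exist two probability vectors $\mathbf p^A=(p^A_i)_{i=0}^N$, $\mathbf p^B=(p^B_i)_{i=0}^N$ such that the pair of lotteries $A=\{\mathbf r,\mathbf p^A\}$, $B=\{\mathbf r,\mathbf p^B\}$ satisfies, for some $\gamma>0$, $$G^A_N-G^B_N=-\gamma\sum_{j=1}^{N-1}\alpha_jc_j,\qquad G^A_i-G^B_i=(G^A_N-G^B_N)+\gamma\alpha_i=\gamma\Big(\alpha_i-\sum_{j=1}^{N-1}\alpha_jc_j\Big),\quad i=1,\dots,N-1,$$ where $\mathbf G^A=\sum_{i=0}^Np_i^A\mathbf g(r_i)$ and $\mathbf G^B=\sum_{i=0}^Np_i^B\mathbf g(r_i)$.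
   Context: The basis mapping $\mathbf g:[x_1,x_{N+1}]\to\mathbb R^N$ associated with the breakpoints is $\mathbf g(x_1)=0$ and $\mathbf g(x)=(1,\dots,1,\frac{x-x_i}{x_{i+1}-x_i},0,\dots,0)^\top$ (with $i-1$ ones followed by the fraction in position $i$ and $N-i$ zeros) for $x\in(x_i,x_{i+1}]$, $i=1,\dots,N$. A lottery $\{\mathbf r,\mathbf p\}$ yields outcome $r_i$ with probability $p_i$, where $p_i\in[0,1]$ and $\sum_{i=0}^Np_i=1$. $G^A_i$ denotes the $i$-th component of $\mathbf G^A$. *)

theory Defs
  imports Complex_Main "HOL-Library.FuncSet"
begin

text \<open>
  Since \<open>N\<close> is an arbitrary natural number and vectors of the lengths \<open>N - 1\<close>, \<open>N\<close> and
  \<open>N + 1\<close> occur together, a real vector is a function \<open>nat \<Rightarrow> real\<close> of which only the values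
  on the stated index range matter: \<open>{1..N-1}\<close> for \<open>\<alpha>\<close> and \<open>c\<close>, \<open>{1..N}\<close> for the values of the
  basis mapping, \<open>{1..N+1}\<close> for the breakpoints, and \<open>{0..N}\<close> for outcomes and probabilities.
\<close>

text \<open>
  Points of the hyperplane are taken extensional on \<open>{1..N-1}\<close>, so that they correspond
  one-to-one to vectors with \<open>N - 1\<close> real components.
\<close>

definition hyperplane :: "nat \<Rightarrow> (nat \<Rightarrow> real) \<Rightarrow> (nat \<Rightarrow> real) \<Rightarrow> (nat \<Rightarrow> real) set" where
  "hyperplane N \<alpha> c =
     {v \<in> {1..N-1} \<rightarrow>\<^sub>E UNIV. (\<Sum>j=1..N-1. \<alpha> j * (v j - c j)) = 0}"

text \<open>
  \<open>basis_map N x y k\<close> is the \<open>k\<close>-th component of the basis mapping at \<open>y\<close>, meaningful for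
  \<open>x 1 \<le> y \<le> x (N + 1)\<close> and \<open>1 \<le> k \<le> N\<close>. For strictly increasing breakpoints the index
  \<open>i\<close> with \<open>x i < y \<le> x (i + 1)\<close> exists and is unique whenever \<open>x 1 < y \<le> x (N + 1)\<close>.
\<close>

definition basis_map :: "nat \<Rightarrow> (nat \<Rightarrow> real) \<Rightarrow> real \<Rightarrow> nat \<Rightarrow> real" where
  "basis_map N x y k =
     (if y = x 1 then 0
      else let i = (THE i. i \<in> {1..N} \<and> y \<in> {x i<..x (i + 1)})
           in if k < i then 1
              else if k = i then (y - x i) / (x (i + 1) - x i)
              else 0)"

definition prob_vector :: "nat \<Rightarrow> (nat \<Rightarrow> real) \<Rightarrow> bool" where
  "prob_vector N p \<longleftrightarrow> (\<forall>i\<in>{0..N}. p i \<in> {0..1}) \<and> (\<Sum>i=0..N. p i) = 1"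

text \<open>The expected basis vector of the lottery with outcomes \<open>r\<close> and probabilities \<open>p\<close>.\<close>

definition lottery_basis ::
    "nat \<Rightarrow> (nat \<Rightarrow> real) \<Rightarrow> (nat \<Rightarrow> real) \<Rightarrow> (nat \<Rightarrow> real) \<Rightarrow> nat \<Rightarrow> real" where
  "lottery_basis N x r p k = (\<Sum>i=0..N. p i * basis_map N x (r i) k)"

end

theory Submission
  imports Defs
begin

text \<open>
  On the outcomes \<open>r 1, \<dots>, r N\<close> the basis vectors form an upper triangular matrix with positive
  diagonal, so every vector is a combination of them. Since \<open>g(r 0) = 0\<close>, the weight of \<open>r 0\<close> is
  free and can make the weights sum to zero. A small multiple of such weights is the difference
  between a probability vector and the uniform one.
\<close>

text \<open>Increasing breakpoints make the half-open intervals disjoint, so the definite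
  description in \<open>basis_map\<close> denotes the given \<open>i\<close>.\<close>

lemma basis_map_eq:
  assumes mono: "strict_mono_on {1..N+1} x" and i: "i \<in> {1..N}" and y: "y \<in> {x i<..x (i + 1)}"
  shows "basis_map N x y k =
    (if k < i then 1 else if k = i then (y - x i) / (x (i + 1) - x i) else 0)"
proof -
  have le: "x a \<le> x b" if "a \<in> {1..N+1}" "b \<in> {1..N+1}" "a \<le> b" for a b
    using strict_mono_on_leD[OF mono that] .
  have "(THE j. j \<in> {1..N} \<and> y \<in> {x j<..x (j + 1)}) = i"
  proof (rule the_equality)
    fix j assume j: "j \<in> {1..N} \<and> y \<in> {x j<..x (j + 1)}"
    show "j = i"
    proof (rule linorder_cases)
      assume "j < i"
      then have "x (j + 1) \<le> x i" using i j by (intro le) auto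
      then show ?thesis using j y by auto
    next
      assume "i < j"
      then have "x (i + 1) \<le> x j" using i j by (intro le) auto
      then show ?thesis using j y by auto
    qed
  qed (use i y in blast)
  \<comment> \<open>This rules out the special case of \<open>basis_map\<close> at the first
    breakpoint.\<close>
  moreover have "y \<noteq> x 1"
    using le[of 1 i] i y by auto
  ultimately show ?thesis
    by (simp add: basis_map_def)
qed

text \<open>Back substitution: the last row alone determines the last unknown \<open>e\<close>,
  which enters every earlier row with coefficient 1. Moving it to the right-hand side leaves a
  system of size \<open>n\<close> for \<open>w k - e\<close>, hence the induction over arbitrary
  \<open>w\<close>.\<close>

lemma upper_triangular_solvable:
  fixes t w :: "nat \<Rightarrow> real"
  assumes "\<forall>k\<in>{1..n}. t k \<noteq> 0"
  shows "\<exists>d. \<forall>k\<in>{1..n}. t k * d k + (\<Sum>i=k+1..n. d i) = w k"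
  using assms
proof (induction n arbitrary: w)
  case 0
  then show ?case by simp
next
  case (Suc n)
  define e where "e = w (Suc n) / t (Suc n)"
  obtain d where d: "\<forall>k\<in>{1..n}. t k * d k + (\<Sum>i=k+1..n. d i) = w k - e"
    using Suc.IH[of "\<lambda>k. w k - e"] Suc.prems by auto
  have "t k * (d(Suc n := e)) k + (\<Sum>i=k+1..Suc n. (d(Suc n := e)) i) = w k"
    if "k \<in> {1..Suc n}" for k
  proof (cases "k = Suc n")
    case True
    then show ?thesis using Suc.prems by (simp add: e_def)
  next
    case False
    then have k: "k \<in> {1..n}" using that by auto
    then show ?thesis using bspec[OF d k] False by simp
  qed
  then show ?case by blast
qed

lemma prob_vector_perturb:
  fixes d :: "nat \<Rightarrow> real"
  assumes sum0: "(\<Sum>i=0..N. d i) = 0"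
  shows "\<exists>p q \<gamma>. prob_vector N p \<and> prob_vector N q \<and> \<gamma> > 0 \<and> (\<forall>i. p i - q i = \<gamma> * d i)"
proof -
  \<comment> \<open>Nonnegative weights with sum 1 are automatically at most 1, so only lower bounds
    need checking.\<close>
  have prob_vectorI: "prob_vector N p"
    if nonneg: "\<forall>i\<in>{0..N}. 0 \<le> p i" and sum1: "(\<Sum>i=0..N. p i) = 1" for p :: "nat \<Rightarrow> real"
  proof -
    have "p i \<le> 1" if "i \<in> {0..N}" for i
      using member_le_sum[of i "{0..N}" p] that nonneg sum1 by auto
    then show ?thesis using nonneg sum1 by (auto simp: prob_vector_def)
  qed
  \<comment> \<open>The summand 1 keeps \<open>S\<close> positive even when \<open>d\<close>
    vanishes.\<close>
  define S where "S = 1 + (\<Sum>i=0..N. \<bar>d i\<bar>)"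
  define q where "q = (\<lambda>i::nat. 1 / real (N + 1))"
  \<comment> \<open>Chosen so that \<open>\<gamma> * S\<close> is exactly the uniform weight; as
    \<open>S\<close> bounds every \<open>\<bar>d i\<bar>\<close>, no weight of \<open>p\<close>
    becomes negative.\<close>
  define \<gamma> where "\<gamma> = 1 / (real (N + 1) * S)"
  define p where "p = (\<lambda>i. q i + \<gamma> * d i)"
  have S: "S > 0"
    unfolding S_def by (simp add: add_pos_nonneg sum_nonneg)
  then have \<gamma>: "\<gamma> > 0"
    by (simp add: \<gamma>_def)
  have sumq: "(\<Sum>i=0..N. q i) = 1"
    by (simp add: q_def)
  have "0 \<le> p i" if "i \<in> {0..N}" for i
  proof -
    have "\<bar>d i\<bar> \<le> S"
      using member_le_sum[of i "{0..N}" "\<lambda>i. \<bar>d i\<bar>"] that by (simp add: S_def)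
    then have "\<gamma> * (- d i) \<le> \<gamma> * S"
      using \<gamma> by (intro mult_left_mono) auto
    also have "\<dots> = q i"
      using S by (simp add: \<gamma>_def q_def)
    finally show ?thesis by (simp add: p_def)
  qed
  moreover have "(\<Sum>i=0..N. p i) = 1"
    using sumq sum0 by (simp add: p_def sum.distrib flip: sum_distrib_left)
  ultimately have "prob_vector N p"
    using prob_vectorI by blast
  moreover have "prob_vector N q"
    using prob_vectorI[of q] sumq by (simp add: q_def)
  ultimately show ?thesis
    using \<gamma> by (intro exI[of _ p] exI[of _ q] exI[of _ \<gamma>]) (simp add: p_def)
qed

lemma lottery_basis_diff_surj:
  fixes w :: "nat \<Rightarrow> real"
  assumes mono: "strict_mono_on {1..N+1} x"
    and r0: "r 0 = x 1"
    and r: "\<forall>i\<in>{1..N}. r i \<in> {x i<..x (i + 1)}"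
  shows "\<exists>p q \<gamma>. prob_vector N p \<and> prob_vector N q \<and> \<gamma> > 0 \<and>
    (\<forall>k\<in>{1..N}. lottery_basis N x r p k - lottery_basis N x r q k = \<gamma> * w k)"
proof -
  define t where "t = (\<lambda>k. (r k - x k) / (x (k + 1) - x k))"
  \<comment> \<open>The intervals are open on the left, so the numerators are positive.\<close>
  have "\<forall>k\<in>{1..N}. t k \<noteq> 0"
    using r by (fastforce simp: t_def)
  then obtain d0 where d0: "\<forall>k\<in>{1..N}. t k * d0 k + (\<Sum>i=k+1..N. d0 i) = w k"
    using upper_triangular_solvable by blast
  \<comment> \<open>Overwriting entry 0 leaves the triangular system intact, since it involves only
    the indices from 1 on.\<close>
  define d where "d = d0(0 := - (\<Sum>i=1..N. d0 i))"
  have "(\<Sum>i=0..N. d i) = 0"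
    by (simp add: d_def sum.atLeast_Suc_atMost)
  then obtain p q \<gamma> where pq: "prob_vector N p" "prob_vector N q" "\<gamma> > 0"
      and diff: "\<And>i. p i - q i = \<gamma> * d i"
    using prob_vector_perturb by blast
  have "lottery_basis N x r p k - lottery_basis N x r q k = \<gamma> * w k" if k: "k \<in> {1..N}" for k
  proof -
    let ?g = "\<lambda>i. basis_map N x (r i) k"
    have g: "?g i = (if k < i then 1 else if k = i then t k else 0)" if "i \<in> {1..N}" for i
      using basis_map_eq[OF mono that] r that by (simp add: t_def)
    have "(\<Sum>i=0..N. d i * ?g i) = (\<Sum>i=1..N. d0 i * ?g i)"
      by (simp add: sum.atLeast_Suc_atMost r0 basis_map_def d_def)
    \<comment> \<open>For \<open>i < k\<close> the vector of \<open>r i\<close> has already dropped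
      to 0 at component \<open>k\<close>; for \<open>i > k\<close> it is still 1 there.\<close>
    also have "\<dots> = (\<Sum>i=k..N. d0 i * ?g i)"
      using k g by (intro sum.mono_neutral_right) auto
    also have "\<dots> = d0 k * ?g k + (\<Sum>i=k+1..N. d0 i * ?g i)"
      using k by (simp add: sum.atLeast_Suc_atMost)
    also have "(\<Sum>i=k+1..N. d0 i * ?g i) = (\<Sum>i=k+1..N. d0 i)"
      using k g by (intro sum.cong) auto
    also have "d0 k * ?g k + (\<Sum>i=k+1..N. d0 i) = w k"
      using bspec[OF d0 k] g[OF k] by (simp add: mult.commute)
    finally have "(\<Sum>i=0..N. d i * ?g i) = w k" .
    moreover have "lottery_basis N x r p k - lottery_basis N x r q k
        = (\<Sum>i=0..N. (p i - q i) * ?g i)"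
      by (simp add: lottery_basis_def left_diff_distrib sum_subtractf)
    ultimately show ?thesis
      by (simp add: diff mult.assoc flip: sum_distrib_left)
  qed
  with pq show ?thesis by blast
qed

theorem theorem4p1:
  fixes N :: nat
    and x r \<alpha> c :: "nat \<Rightarrow> real"
    and H :: "(nat \<Rightarrow> real) set"
  assumes "N \<ge> 3"
    and "strict_mono_on {1..N+1} x"
    and "\<exists>j\<in>{1..N-1}. \<alpha> j \<noteq> 0"
    and "H = hyperplane N \<alpha> c"
    and "r 0 = x 1"
    and "\<forall>i\<in>{1..N}. r i \<in> {x i<..x (i + 1)}"
  shows "\<exists>pA pB. prob_vector N pA \<and> prob_vector N pB \<and>
    (let GA = lottery_basis N x r pA; GB = lottery_basis N x r pB in
      \<exists>\<gamma>>0.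
        GA N - GB N = - \<gamma> * (\<Sum>j=1..N-1. \<alpha> j * c j) \<and>
        (\<forall>i\<in>{1..N-1}.
          GA i - GB i = (GA N - GB N) + \<gamma> * \<alpha> i \<and>
          (GA N - GB N) + \<gamma> * \<alpha> i = \<gamma> * (\<alpha> i - (\<Sum>j=1..N-1. \<alpha> j * c j))))"
proof -
  let ?s = "\<Sum>j=1..N-1. \<alpha> j * c j"
  \<comment> \<open>The required differences divided by \<open>\<gamma>\<close>; the entry at
    \<open>N\<close> is separate because \<open>\<alpha>\<close> has only \<open>N - 1\<close>
    components.\<close>
  let ?w = "\<lambda>k. if k = N then - ?s else \<alpha> k - ?s"
  obtain pA pB \<gamma> where p: "prob_vector N pA" "prob_vector N pB" and \<gamma>: "\<gamma> > 0"
    and w: "\<And>k. k \<in> {1..N} \<Longrightarrow>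
      lottery_basis N x r pA k - lottery_basis N x r pB k = \<gamma> * ?w k"
    using lottery_basis_diff_surj[OF assms(2,5,6), of ?w] by blast
  have N: "lottery_basis N x r pA N - lottery_basis N x r pB N = - \<gamma> * ?s"
    using w[of N] \<open>N \<ge> 3\<close> by simp
  have i: "lottery_basis N x r pA i - lottery_basis N x r pB i = \<gamma> * (\<alpha> i - ?s)"
    if "i \<in> {1..N-1}" for i
  proof -
    have "i \<in> {1..N}" "i \<noteq> N" using that by auto
    then show ?thesis using w[of i] by simp
  qed
  have eq: "- \<gamma> * ?s + \<gamma> * \<alpha> i = \<gamma> * (\<alpha> i - ?s)" for i
    by (simp add: right_diff_distrib)
  show ?thesis
    unfolding Let_def
    by (intro exI[of _ pA] exI[of _ pB] exI[of _ \<gamma>] conjI ballI p \<gamma> N)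
      (simp_all only: N i eq)
qed

end
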